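(* Let $n\ge 1$. For $\ell_B$: (1) $\displaystyle\sum_{\pi\in B_n}(-1)^{\ell_B(\pi)}q^{\ell_B(\pi)}=\prod_{k=1}^n[2k]_{-q}$; (2) $\displaystyle\sum_{\pi\in B_n}(-1)^{\mathrm{neg}(\pi)}q^{\ell_B(\pi)}=\prod_{k=1}^n[2]_{-q^k}[k]_q$; (3) $\displaystyle\sum_{\pi\in B_n}(-1)^{\mathrm{inv}(|\pi|)}q^{\ell_B(\pi)}=\prod_{k=1}^n[2]_{(-1)^{k-1}q^k}[k]_{-q}$. For $\mathrm{nmaj}$: (1) $\displaystyle\sum_{\pi\in B_n}(-1)^{\ell_B(\pi)}q^{\mathrm{nmaj}(\pi)} =\prod_{k=1}^n[2]_{(-q)^k}[k]_{(-1)^{k-1}q}$; (2) $\displaystyle\sum_{\pi\in B_n}(-1)^{\mathrm{neg}(\pi)}q^{\mathrm{nmaj}(\pi)}=\prod_{k=1}^n[2]_{-q^k}[k]_q$; (3) $\displaystyle\sum_{\pi\in B_n}(-1)^{\mathrm{inv}(|\pi|)}q^{\mathrm{nmaj}(\pi)}=\prod_{k=1}^n[2]_{(-1)^{k-1}q^k}[k]_{(-1)^{k-1}q}$.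
   Context: For an integer $m\ge 0$ and any quantity $p$, $[m]_p:=1+p+\cdots+p^{m-1}$. $B_n$ is the group of signed permutations: bijections $\pi$ of $\{\pm1,\dots,\pm n\}$ with $\pi(-i)=-\pi(i)$, written $\pi=\pi_1\cdots\pi_n$ with $\pi_i=\pi(i)$. Put $|\pi|:=|\pi_1|\cdots|\pi_n|\in\mathfrak S_n$, $\mathrm{Neg}(\pi):=\{i\in\{1,\dots,n\}:\pi_i<0\}$ and $\mathrm{neg}(\pi):=|\mathrm{Neg}(\pi)|$. With respect to the usual order of the integers, $\mathrm{inv}(\pi):=|\{(i,j):1\le i<j\le n,\ \pi_i>\pi_j\}|$ and $\mathrm{maj}(\pi):=\sum_{1\le i\le n-1,\ \pi_i>\pi_{i+1}} i$. $\ell_B$ is the Coxeter length function of $B_n$ with respect to the generators $s_0=(1,-1)$ and $s_i=(i,i+1)$, $1\le i\le n-1$; it satisfies $\ell_B(\pi)=\mathrm{inv}(\pi)-\sum_{i\in\mathrm{Neg}(\pi)}\pi_i$. The negative major index is $\mathrm{nmaj}(\pi):=\mathrm{maj}(\pi)-\sum_{i\in\mathrm{Neg}(\pi)}\pi_i$. *)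

theory Defs
  imports Complex_Main "HOL-Combinatorics.Permutations"
begin

definition q_bracket :: "nat \<Rightarrow> 'a::comm_ring_1 \<Rightarrow> 'a"
  where "q_bracket m p = (\<Sum>i<m. p ^ i)"

text \<open>As usual for \<open>permutes\<close>, a signed permutation is extended by the identity outside
  \<open>{\<plusminus>1, \<dots>, \<plusminus>n}\<close>; since that set is symmetric, oddness can be demanded everywhere.\<close>

definition signed_perms :: "nat \<Rightarrow> (int \<Rightarrow> int) set"
  where "signed_perms n =
    {\<pi>. \<pi> permutes ({- int n..int n} - {0}) \<and> (\<forall>i. \<pi> (- i) = - \<pi> i)}"

definition abs_perm :: "nat \<Rightarrow> (int \<Rightarrow> int) \<Rightarrow> int \<Rightarrow> int"
  where "abs_perm n \<pi> = (\<lambda>i. if i \<in> {1..int n} then \<bar>\<pi> i\<bar> else i)"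

definition Neg :: "nat \<Rightarrow> (int \<Rightarrow> int) \<Rightarrow> nat set"
  where "Neg n \<pi> = {i \<in> {1..n}. \<pi> (int i) < 0}"

definition neg :: "nat \<Rightarrow> (int \<Rightarrow> int) \<Rightarrow> nat"
  where "neg n \<pi> = card (Neg n \<pi>)"

definition inv_num :: "nat \<Rightarrow> (int \<Rightarrow> int) \<Rightarrow> nat"
  where "inv_num n \<pi> =
    card {(i, j). 1 \<le> i \<and> i < j \<and> j \<le> n \<and> \<pi> (int i) > \<pi> (int j)}"

definition maj :: "nat \<Rightarrow> (int \<Rightarrow> int) \<Rightarrow> nat"
  where "maj n \<pi> = \<Sum>{i. 1 \<le> i \<and> i < n \<and> \<pi> (int i) > \<pi> (int i + 1)}"

text \<open>The argument of \<open>nat\<close> is nonnegative, as only negative values of \<open>\<pi>\<close> are subtracted.\<close>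

definition nmaj :: "nat \<Rightarrow> (int \<Rightarrow> int) \<Rightarrow> nat"
  where "nmaj n \<pi> = nat (int (maj n \<pi>) - (\<Sum>i\<in>Neg n \<pi>. \<pi> (int i)))"

text \<open>For \<open>i \<ge> 1\<close> the generator \<open>(i, i+1)\<close> of \<open>B\<^sub>n\<close> also exchanges \<open>-i\<close> and \<open>-(i+1)\<close>, being odd.\<close>

definition gen_B :: "nat \<Rightarrow> int \<Rightarrow> int"
  where "gen_B i =
    (if i = 0 then transpose 1 (- 1)
     else transpose (int i) (int i + 1) \<circ> transpose (- int i) (- (int i + 1)))"

definition length_B :: "nat \<Rightarrow> (int \<Rightarrow> int) \<Rightarrow> nat"
  where "length_B n \<pi> =
    (LEAST k. \<exists>ws. length ws = k \<and> set ws \<subseteq> {0..<n} \<and> \<pi> = foldr (\<circ>) (map gen_B ws) id)"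

end

theory Submission
  imports Defs "HOL-Combinatorics.Multiset_Permutations"
begin

text \<open>
  A signed permutation \<open>\<pi>\<close> is determined by the set \<open>N\<close> of the absolute values of its negative
  letters together with the order in which the resulting \<open>n\<close> distinct integers are arranged. All
  six weights split along this decomposition. Both \<open>\<ell>\<^sub>B\<close> and \<open>nmaj\<close> exceed the inversion number,
  respectively the major index, of the arrangement by the sum of \<open>N\<close>
  (\<open>length_B_eq\<close>, \<open>nmaj_eq\<close>). Each of the three signs is a product over \<open>N\<close>, times the sign of the
  arrangement in two cases: \<open>neg\<close> is the size of \<open>N\<close>, the parity of \<open>\<ell>\<^sub>B\<close> follows from the formula
  for \<open>\<ell>\<^sub>B\<close>, and \<open>\<bar>\<pi>\<bar>\<close> and \<open>\<pi>\<close> order a pair of letters differently exactly when the letter of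
  larger absolute value is negative, so that \<open>inv \<bar>\<pi>\<bar>\<close> and \<open>inv \<pi>\<close> differ modulo 2 by the sum of
  \<open>k - 1\<close> over \<open>k \<in> N\<close> (\<open>parity_inv_num_abs_perm\<close>).

  The weight of an arrangement depends only on the relative order of its letters, so its sum over all
  arrangements is the same for every \<open>N\<close>. The sum over \<open>N\<close> of the remaining factor
  \<open>\<Prod>k\<in>N. y k\<close> is \<open>\<Prod>k=1..n. 1 + y k\<close> (\<open>sum_signed_perms_weighted\<close>). What is left are
  two generating functions over the arrangements of a finite set. For inversions the first letter
  contributes its rank (\<open>sum_power_word_inv\<close>). For the major index, weighted by a sign \<open>x\<close> per
  inversion, a cyclic shift of the values lowers the major index by one and multiplies the sign by
  that of an \<open>n\<close>-cycle, as long as the last letter is not the largest one; iterating it turns the words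
  that end with the largest letter into those that end with any given letter
  (\<open>sum_sign_power_word_maj\<close>). The case \<open>x = 1\<close> is MacMahon's theorem, and \<open>x = - 1\<close> is the
  theorem of Gessel and Simion.

  The formula for \<open>\<ell>\<^sub>B\<close> holds because multiplication by a generator changes its right-hand side by
  exactly one, downwards precisely at a descent, and only the identity has no descent.
\<close>

section \<open>Inversions and major index of words\<close>

fun word_inv :: "'a::linorder list \<Rightarrow> nat" where
  "word_inv [] = 0"
| "word_inv (a # w) = length (filter (\<lambda>b. b < a) w) + word_inv w"

text \<open>The first letter is taken to stand at position \<open>k\<close>. With this parameter the major index of a
  concatenation can be computed from its parts.\<close>
fun maj_from :: "nat \<Rightarrow> 'a::linorder list \<Rightarrow> nat" where
  "maj_from k (a # b # w) = (if b < a then k else 0) + maj_from (Suc k) (b # w)"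
| "maj_from k w = 0"

abbreviation "word_maj \<equiv> maj_from (Suc 0)"

lemma word_inv_append:
  "word_inv (u @ v) = word_inv u + word_inv v + (\<Sum>a\<leftarrow>u. length (filter (\<lambda>b. b < a) v))"
  by (induction u) auto

lemma maj_from_append:
  "maj_from k (u @ a # v) = maj_from k (u @ [a]) + maj_from (k + length u) (a # v)"
  by (induction k u rule: maj_from.induct) auto

lemma word_inv_map:
  assumes "strict_mono_on A f" "set w \<subseteq> A"
  shows "word_inv (map f w) = word_inv w"
  using assms(2)
proof (induction w)
  case (Cons a w)
  have "filter (\<lambda>b. f b < f a) w = filter (\<lambda>b. b < a) w"
    using Cons.prems strict_mono_on_less[OF assms(1)] by (intro filter_cong) auto
  then show ?case using Cons by (simp add: filter_map o_def)
qed simp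

lemma maj_from_map:
  assumes "strict_mono_on A f" "set w \<subseteq> A"
  shows "maj_from k (map f w) = maj_from k w"
  using assms(2)
  by (induction k w rule: maj_from.induct) (auto simp: strict_mono_on_less[OF assms(1)])

text \<open>A largest letter forms inversions with exactly the letters after it and a descent only with its
  right neighbour; a smallest letter does so with the letters before it and with its left neighbour.
  Comparing the two situations shows the effect of turning the largest value into the smallest.\<close>
lemma word_inv_remove_max:
  assumes "\<forall>a \<in> set u \<union> set v. a < m"
  shows "word_inv (u @ m # v) = word_inv (u @ v) + length v"
proof -
  have "filter (\<lambda>b. b < m) v = v" using assms by (auto simp: filter_id_conv)
  moreover have "(\<Sum>a\<leftarrow>u. length (filter (\<lambda>b. b < a) (m # v))) = (\<Sum>a\<leftarrow>u. length (filter (\<lambda>b. b < a) v))"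
    using assms by (intro arg_cong[of _ _ sum_list] map_cong) (auto dest: less_asym)
  ultimately show ?thesis by (simp add: word_inv_append)
qed

lemma word_inv_remove_min:
  assumes "\<forall>a \<in> set u \<union> set v. m < a"
  shows "word_inv (u @ m # v) = word_inv (u @ v) + length u"
proof -
  have "filter (\<lambda>b. b < m) v = []" using assms by (auto simp: filter_empty_conv dest: less_asym)
  moreover have "(\<Sum>a\<leftarrow>u. length (filter (\<lambda>b. b < a) (m # v))) = (\<Sum>a\<leftarrow>u. Suc (length (filter (\<lambda>b. b < a) v)))"
    using assms by (intro arg_cong[of _ _ sum_list] map_cong) auto
  ultimately show ?thesis by (simp add: word_inv_append sum_list_addf sum_list_Suc)
qed

lemma maj_from_remove_max:
  assumes "\<forall>a \<in> set u \<union> set v. a < m"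
  shows "maj_from k (u @ m # v) =
    maj_from k u + (if v = [] then 0 else k + length u) + maj_from (Suc (k + length u)) v"
proof -
  have "maj_from k (u @ [m]) = maj_from k u"
    using assms by (induction k u rule: maj_from.induct) auto
  moreover have "maj_from j (m # v) = (if v = [] then 0 else j) + maj_from (Suc j) v" for j
    using assms by (cases v) auto
  ultimately show ?thesis by (subst maj_from_append) simp
qed

lemma maj_from_remove_min:
  assumes "\<forall>a \<in> set u \<union> set v. m < a"
  shows "maj_from k (u @ m # v) =
    maj_from k u + (if u = [] then 0 else k + length u - 1) + maj_from (Suc (k + length u)) v"
proof -
  have "maj_from k (u @ [m]) = maj_from k u + (if u = [] then 0 else k + length u - 1)"
    using assms by (induction k u rule: maj_from.induct) auto
  moreover have "maj_from j (m # v) = maj_from (Suc j) v" for j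
    using assms by (cases v) auto
  ultimately show ?thesis by (subst maj_from_append) simp
qed

lemma length_filter_distinct:
  "distinct w \<Longrightarrow> length (filter P w) = card {b \<in> set w. P b}"
  by (metis distinct_card distinct_filter set_filter)

section \<open>The inversion generating function\<close>

lemma sum_permutations_of_set_Cons:
  assumes "finite A" "A \<noteq> {}"
  shows "(\<Sum>w\<in>permutations_of_set A. F w) = (\<Sum>a\<in>A. \<Sum>w\<in>permutations_of_set (A - {a}). F (a # w))"
proof -
  have "(\<Sum>w\<in>permutations_of_set A. F w) =
      (\<Sum>a\<in>A. \<Sum>w\<in>(#) a ` permutations_of_set (A - {a}). F w)"
    unfolding permutations_of_set_nonempty[OF assms(2)]
    using assms(1) by (intro sum.UNION_disjoint) auto
  then show ?thesis by (simp add: sum.reindex)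
qed

lemma sum_permutations_of_set_snoc:
  assumes "finite A" "A \<noteq> {}"
  shows "(\<Sum>w\<in>permutations_of_set A. F w) = (\<Sum>a\<in>A. \<Sum>w\<in>permutations_of_set (A - {a}). F (w @ [a]))"
proof -
  have rev: "(\<Sum>w\<in>permutations_of_set B. G (rev w)) = (\<Sum>w\<in>permutations_of_set B. G w)"
    for B :: "'a set" and G :: "'a list \<Rightarrow> 'b"
    by (subst (2) rev_permutations_of_set[symmetric], subst sum.reindex) auto
  have "(\<Sum>w\<in>permutations_of_set A. F w) = (\<Sum>w\<in>permutations_of_set A. F (rev w))"
    by (simp add: rev)
  also have "\<dots> = (\<Sum>a\<in>A. \<Sum>w\<in>permutations_of_set (A - {a}). F (rev w @ [a]))"
    by (simp add: sum_permutations_of_set_Cons[OF assms])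
  also have "\<dots> = (\<Sum>a\<in>A. \<Sum>w\<in>permutations_of_set (A - {a}). F (w @ [a]))"
    using rev[where G = "\<lambda>w. F (w @ [_])"] by simp
  finally show ?thesis .
qed

lemma sum_permutations_of_set_image:
  assumes "inj_on f A"
  shows "(\<Sum>w\<in>permutations_of_set (f ` A). F w) = (\<Sum>w\<in>permutations_of_set A. F (map f w))"
proof -
  have "inj_on (map f) (permutations_of_set A)"
    by (rule inj_on_mapI, rule inj_on_subset[OF assms]) (auto simp: permutations_of_set_def)
  then show ?thesis by (simp add: permutations_of_set_image_inj[OF assms] sum.reindex)
qed

lemma sum_power_rank:
  fixes q :: "'b::comm_ring_1"
  assumes "finite (A :: 'a::linorder set)"
  shows "(\<Sum>a\<in>A. q ^ card {b \<in> A. b < a}) = q_bracket (card A) q"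
  using assms
proof (induction rule: finite_linorder_max_induct)
  case empty
  then show ?case by (simp add: q_bracket_def)
next
  case (insert m A)
  have "{b \<in> insert m A. b < m} = A" using insert by auto
  moreover have "{b \<in> insert m A. b < a} = {b \<in> A. b < a}" if "a \<in> A" for a
    using insert that by force
  moreover have "m \<notin> A" using insert by blast
  ultimately show ?case using insert by (simp add: q_bracket_def add.commute cong: conj_cong)
qed

text \<open>The first letter forms as many inversions with the rest as there are smaller letters, and the
  ranks of the possible first letters are \<open>0, \<dots>, card A - 1\<close>.\<close>
theorem sum_power_word_inv:
  fixes q :: "'b::comm_ring_1"
  assumes "finite (A :: 'a::linorder set)"
  shows "(\<Sum>w\<in>permutations_of_set A. q ^ word_inv w) = (\<Prod>k=1..card A. q_bracket k q)"
  using assms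
proof (induction "card A" arbitrary: A)
  case 0
  then show ?case by simp
next
  case (Suc m)
  then have "A \<noteq> {}" by auto
  have "(\<Sum>w\<in>permutations_of_set A. q ^ word_inv w) =
      (\<Sum>a\<in>A. \<Sum>w\<in>permutations_of_set (A - {a}). q ^ card {b \<in> A. b < a} * q ^ word_inv w)"
  proof (subst sum_permutations_of_set_Cons, goal_cases)
    case 3
    have "length (filter (\<lambda>b. b < a) w) = card {b \<in> A. b < a}"
      if "w \<in> permutations_of_set (A - {a})" for a w
    proof -
      have "length (filter (\<lambda>b. b < a) w) = card (set (filter (\<lambda>b. b < a) w))"
        using that by (intro distinct_card[symmetric]) (simp add: permutations_of_set_def)
      also have "set (filter (\<lambda>b. b < a) w) = {b \<in> A. b < a}"
        using that by (auto simp: permutations_of_set_def)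
      finally show ?thesis .
    qed
    then show ?case by (simp add: power_add)
  qed (use Suc \<open>A \<noteq> {}\<close> in auto)
  also have "\<dots> = (\<Sum>a\<in>A. q ^ card {b \<in> A. b < a}) * (\<Prod>k=1..m. q_bracket k q)"
  proof -
    have "(\<Sum>w\<in>permutations_of_set (A - {a}). q ^ word_inv w) = (\<Prod>k=1..m. q_bracket k q)"
      if "a \<in> A" for a
      using Suc(1)[of "A - {a}"] Suc(3) that by (simp flip: Suc(2))
    then show ?thesis by (simp add: sum_distrib_left[symmetric] sum_distrib_right)
  qed
  also have "\<dots> = (\<Prod>k=1..card A. q_bracket k q)"
    using Suc(2,3) by (simp add: sum_power_rank flip: Suc(2))
  finally show ?case .
qed

section \<open>The signed generating function of the major index\<close>

text \<open>This is \<open>v \<mapsto> v + j + 1\<close> modulo \<open>m + 1\<close> for \<open>v \<le> m\<close>, that is, the cyclic shift of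
  \<open>{0, \<dots>, m}\<close> iterated \<open>j + 1\<close> times. It sends the largest value \<open>m\<close> to \<open>j\<close>.\<close>
definition shift_value :: "nat \<Rightarrow> nat \<Rightarrow> nat \<Rightarrow> nat" where
  "shift_value m j v = (if v + j < m then Suc (v + j) else v + j - m)"

lemma shift_value_inj: "inj_on (shift_value m j) {..<m}"
  by (auto simp: inj_on_def shift_value_def split: if_splits)

lemma shift_value_image:
  assumes "j \<le> m"
  shows "shift_value m j ` {..<m} = {..<Suc m} - {j}"
proof (intro equalityI subsetI)
  fix v assume "v \<in> {..<Suc m} - {j}"
  then have "v = shift_value m j (if j < v then v - Suc j else v + m - j)"
    and "(if j < v then v - Suc j else v + m - j) < m"
    using assms by (auto simp: shift_value_def)
  then show "v \<in> shift_value m j ` {..<m}" by blast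
qed (use assms in \<open>auto simp: shift_value_def split: if_splits\<close>)

text \<open>The shift keeps the relative order of all letters except that \<open>m\<close>, once the largest, becomes the
  smallest. If \<open>m\<close> stands at position \<open>p\<close>, before the end, then the descent at \<open>p\<close> moves to
  \<open>p - 1\<close>, which for \<open>p = 1\<close> means that it disappears: in all cases the major index drops by one. The
  letters after \<open>m\<close> stop forming inversions with it and those before it start to, which
  changes the parity of the inversion number by that of \<open>m\<close>, the total number of these letters.\<close>
lemma weight_cycle_values:
  fixes x q :: "'b::comm_ring_1"
  assumes x: "x * x = 1" and u: "u @ [j] \<in> permutations_of_set {..<Suc m}" and "j \<noteq> m"
  shows "x ^ word_inv (u @ [j]) * q ^ word_maj (u @ [j]) =
    (x ^ m * q) * (x ^ word_inv (map (shift_value m 0) (u @ [j])) *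
      q ^ word_maj (map (shift_value m 0) (u @ [j])))"
proof -
  let ?T = "shift_value m 0"
  have set_u: "set (u @ [j]) = {..<Suc m}" and dist: "distinct (u @ [j])"
    using u by (simp_all add: permutations_of_set_def)
  have "m \<in> set (u @ [j])" unfolding set_u by simp
  then obtain xs zs where split: "u @ [j] = xs @ m # zs" by (meson split_list)
  with \<open>j \<noteq> m\<close> have "zs \<noteq> []" by auto
  have len: "length xs + length zs = m"
    using length_finite_permutations_of_set[OF u] unfolding split by simp
  have lt: "\<forall>a \<in> set xs \<union> set zs. a < m"
  proof
    fix a assume a: "a \<in> set xs \<union> set zs"
    then have "a \<in> set (u @ [j])" unfolding split by auto
    then have "a < Suc m" unfolding set_u by simp
    moreover have "a \<noteq> m" using dist a unfolding split by auto
    ultimately show "a < m" by simp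
  qed
  have T: "map ?T (u @ [j]) = map Suc xs @ 0 # map Suc zs"
    unfolding split using lt by (simp add: shift_value_def)
  have mono: "strict_mono_on UNIV Suc" by (simp add: strict_mono_on_def)
  have "word_inv (map Suc xs @ 0 # map Suc zs) = word_inv (map Suc (xs @ zs)) + length xs"
    by (subst word_inv_remove_min) auto
  then have "word_inv (map ?T (u @ [j])) + length zs = word_inv (u @ [j]) + length xs"
    unfolding T unfolding split
    by (simp add: word_inv_remove_max[OF lt] word_inv_map[OF mono] del: map_append)
  then have "x ^ m * x ^ word_inv (map ?T (u @ [j])) =
      x ^ word_inv (u @ [j]) * (x ^ length xs * x ^ length xs)"
    by (simp only: len[symmetric] power_add[symmetric]) (simp add: algebra_simps)
  \<comment> \<open>\<open>x\<close> is a sign, so only the parity of the exponents matters and the doubled \<open>length xs\<close> drops out.\<close>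
  then have inv: "x ^ word_inv (u @ [j]) = x ^ m * x ^ word_inv (map ?T (u @ [j]))"
    using x by (simp flip: power_mult_distrib)
  have "word_maj (map Suc xs @ 0 # map Suc zs) =
      word_maj xs + length xs + maj_from (Suc (Suc (length xs))) zs"
    by (subst maj_from_remove_min) (auto simp: maj_from_map[OF mono])
  then have "word_maj (u @ [j]) = Suc (word_maj (map ?T (u @ [j])))"
    unfolding T unfolding split using \<open>zs \<noteq> []\<close> by (simp add: maj_from_remove_max[OF lt])
  with inv show ?thesis by (simp add: mult_ac)
qed

text \<open>Applying the shift to a word whose last letter is \<open>j < m\<close> makes the last letter \<open>j + 1\<close>. So the
  words ending with \<open>j\<close> are linked to those ending with \<open>m\<close> by \<open>m - j\<close> applications of the
  previous lemma, and a final letter \<open>m\<close> contributes nothing.\<close>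
lemma weight_cycle_values_iterated:
  fixes x q :: "'b::comm_ring_1"
  assumes x: "x * x = 1" and w: "w \<in> permutations_of_set {..<m}" and "j \<le> m"
  shows "x ^ word_inv (map (shift_value m j) w @ [j]) *
      q ^ word_maj (map (shift_value m j) w @ [j]) =
    (x ^ m * q) ^ (m - j) * (x ^ word_inv w * q ^ word_maj w)"
  using \<open>j \<le> m\<close>
proof (induction rule: inc_induct)
  case base
  have lt: "\<forall>a \<in> set w. a < m" using w by (simp add: permutations_of_set_def)
  then have "map (shift_value m m) w = w" by (intro map_idI) (simp add: shift_value_def)
  then show ?case
    using lt word_inv_remove_max[of w "[]" m] maj_from_remove_max[of w "[]" m "Suc 0"] by simp
next
  case (step j)
  have w': "map (shift_value m j) w @ [j] \<in> permutations_of_set {..<Suc m}"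
    using w step(2) shift_value_inj[of m j] shift_value_image[of j m]
    by (auto simp: permutations_of_set_def distinct_map)
  have lt: "\<forall>a \<in> set w. a < m" using w by (simp add: permutations_of_set_def)
  have "map (shift_value m 0) (map (shift_value m j) w @ [j]) = map (shift_value m (Suc j)) w @ [Suc j]"
    using lt step(2) by (auto simp: shift_value_def)
  with weight_cycle_values[OF x w', of q] step.IH
  have "x ^ word_inv (map (shift_value m j) w @ [j]) * q ^ word_maj (map (shift_value m j) w @ [j]) =
      (x ^ m * q) * ((x ^ m * q) ^ (m - Suc j) * (x ^ word_inv w * q ^ word_maj w))"
    using step(2) by (simp del: map_append map_map)
  also have "\<dots> = (x ^ m * q) ^ (m - j) * (x ^ word_inv w * q ^ word_maj w)"
    using step(2) by (simp only: mult.assoc[symmetric] power_Suc[symmetric] Suc_diff_Suc)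
  finally show ?case .
qed

text \<open>Classified by the last letter \<open>j\<close>, the words over \<open>{0, \<dots>, m}\<close> are the shifts of the words
  ending with \<open>m\<close>, and the last letter contributes \<open>(x ^ m * q) ^ (m - j)\<close>. For \<open>x = - 1\<close> the sign
  of the cyclic shift is what puts \<open>(- 1) ^ (k - 1)\<close> into the \<open>k\<close>-th factor.\<close>
theorem sum_sign_power_word_maj_lessThan:
  fixes x q :: "'b::comm_ring_1"
  assumes x: "x * x = 1"
  shows "(\<Sum>w\<in>permutations_of_set {..<n}. x ^ word_inv w * q ^ word_maj w) =
    (\<Prod>k=1..n. q_bracket k (x ^ (k - 1) * q))"
proof (induction n)
  case 0
  then show ?case by simp
next
  case (Suc m)
  let ?f = "shift_value m" and ?c = "x ^ m * q"
  have "(\<Sum>w\<in>permutations_of_set {..<Suc m}. x ^ word_inv w * q ^ word_maj w) =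
      (\<Sum>j<Suc m. \<Sum>w\<in>permutations_of_set ({..<Suc m} - {j}).
        x ^ word_inv (w @ [j]) * q ^ word_maj (w @ [j]))"
    by (intro sum_permutations_of_set_snoc) auto
  also have "\<dots> = (\<Sum>j<Suc m. \<Sum>w\<in>permutations_of_set {..<m}.
        ?c ^ (Suc m - Suc j) * (x ^ word_inv w * q ^ word_maj w))"
  proof (rule sum.cong[OF refl])
    fix j assume "j \<in> {..<Suc m}"
    then have inj: "inj_on (?f j) {..<m}" and img: "?f j ` {..<m} = {..<Suc m} - {j}"
      by (simp_all add: shift_value_inj shift_value_image)
    have "(\<Sum>w\<in>permutations_of_set ({..<Suc m} - {j}). x ^ word_inv (w @ [j]) * q ^ word_maj (w @ [j])) =
        (\<Sum>w\<in>permutations_of_set {..<m}. x ^ word_inv (map (?f j) w @ [j]) * q ^ word_maj (map (?f j) w @ [j]))"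
      unfolding img[symmetric] by (rule sum_permutations_of_set_image[OF inj])
    also have "\<dots> = (\<Sum>w\<in>permutations_of_set {..<m}. ?c ^ (Suc m - Suc j) * (x ^ word_inv w * q ^ word_maj w))"
      using \<open>j \<in> {..<Suc m}\<close> by (intro sum.cong refl) (simp add: weight_cycle_values_iterated[OF x])
    finally show "(\<Sum>w\<in>permutations_of_set ({..<Suc m} - {j}). x ^ word_inv (w @ [j]) * q ^ word_maj (w @ [j])) =
      (\<Sum>w\<in>permutations_of_set {..<m}. ?c ^ (Suc m - Suc j) * (x ^ word_inv w * q ^ word_maj w))" .
  qed
  also have "\<dots> = (\<Sum>j<Suc m. ?c ^ (Suc m - Suc j)) * (\<Prod>k=1..m. q_bracket k (x ^ (k - 1) * q))"
    by (simp only: sum_distrib_left[symmetric] Suc.IH sum_distrib_right)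
  also have "(\<Sum>j<Suc m. ?c ^ (Suc m - Suc j)) = q_bracket (Suc m) ?c"
    unfolding q_bracket_def by (rule sum.nat_diff_reindex)
  finally show ?case by (simp add: mult.commute)
qed

text \<open>Inversions and descents depend only on the relative order of the letters, so the increasing
  enumeration of \<open>A\<close> reduces the claim to an initial segment of the natural numbers.\<close>
theorem sum_sign_power_word_maj:
  fixes x q :: "'b::comm_ring_1"
  assumes x: "x * x = 1" and A: "finite (A :: 'a::linorder set)"
  shows "(\<Sum>w\<in>permutations_of_set A. x ^ word_inv w * q ^ word_maj w) =
    (\<Prod>k=1..card A. q_bracket k (x ^ (k - 1) * q))"
proof -
  define h where "h = (!) (sorted_list_of_set A)"
  have mono: "strict_mono_on {..<card A} h"
    using A by (auto simp: strict_mono_on_def h_def sorted_wrt_nth_less)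
  have inj: "inj_on h {..<card A}" using mono by (rule strict_mono_on_imp_inj_on)
  have img: "h ` {..<card A} = A"
    using A set_conv_nth[of "sorted_list_of_set A"] by (auto simp: h_def)
  have "(\<Sum>w\<in>permutations_of_set (h ` {..<card A}). x ^ word_inv w * q ^ word_maj w) =
      (\<Sum>w\<in>permutations_of_set {..<card A}. x ^ word_inv (map h w) * q ^ word_maj (map h w))"
    by (rule sum_permutations_of_set_image[OF inj])
  also have "\<dots> = (\<Sum>w\<in>permutations_of_set {..<card A}. x ^ word_inv w * q ^ word_maj w)"
    by (intro sum.cong refl)
       (simp add: word_inv_map[OF mono] maj_from_map[OF mono] permutations_of_set_def)
  finally show ?thesis unfolding img sum_sign_power_word_maj_lessThan[OF x] .
qed

section \<open>Signed permutations as words\<close>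

text \<open>The window notation \<open>\<pi>\<^sub>1 \<dots> \<pi>\<^sub>n\<close>; list positions start at 0, hence the \<open>Suc\<close>.\<close>
definition window :: "nat \<Rightarrow> (int \<Rightarrow> int) \<Rightarrow> int list" where
  "window n f = map (\<lambda>k. f (int (Suc k))) [0..<n]"

definition signed_words :: "nat \<Rightarrow> int list set" where
  "signed_words n = {w. map abs w \<in> permutations_of_set {1..int n}}"

definition neg_letters :: "int list \<Rightarrow> nat set" where
  "neg_letters w = {k. k \<noteq> 0 \<and> - int k \<in> set w}"

lemma length_window [simp]: "length (window n f) = n"
  by (simp add: window_def)

lemma window_nth [simp]: "k < n \<Longrightarrow> window n f ! k = f (int (Suc k))"
  by (simp add: window_def)

lemma window_Suc: "window (Suc n) f = window n f @ [f (int (Suc n))]"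
  by (simp add: window_def)

lemma set_window: "set (window n f) = (\<lambda>k. f (int k)) ` {1..n}"
proof -
  have "{1..n} = Suc ` {0..<n}" by (simp add: atLeastLessThanSuc_atLeastAtMost)
  then show ?thesis by (simp only: window_def set_map set_upt image_image)
qed

lemma inv_num_eq_word_inv: "inv_num n f = word_inv (window n f)"
proof (induction n)
  case 0
  have "inv_num 0 f = card ({} :: (nat \<times> nat) set)" unfolding inv_num_def by (rule arg_cong[of _ _ card]) auto
  then show ?case by (simp add: window_def)
next
  case (Suc n)
  let ?I = "\<lambda>m. {(i, j). 1 \<le> i \<and> i < j \<and> j \<le> m \<and> f (int i) > f (int j)}"
  let ?J = "{i \<in> {1..n}. f (int i) > f (int (Suc n))}"
  have split: "?I (Suc n) = ?I n \<union> (\<lambda>i. (i, Suc n)) ` ?J"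
    by (auto simp: le_Suc_eq)
  have "finite (?I n)" by (rule finite_subset[of _ "{..n} \<times> {..n}"]) auto
  then have "card (?I (Suc n)) = card (?I n) + card ((\<lambda>i. (i, Suc n)) ` ?J)"
    unfolding split by (intro card_Un_disjoint) auto
  also have "card ((\<lambda>i. (i, Suc n)) ` ?J) = card ?J"
    by (intro card_image) (auto simp: inj_on_def)
  also have "?J = Suc ` {k. k < n \<and> f (int (Suc n)) < f (int (Suc k))}"
  proof (intro equalityI subsetI)
    fix i assume "i \<in> ?J"
    then show "i \<in> Suc ` {k. k < n \<and> f (int (Suc n)) < f (int (Suc k))}"
      by (intro image_eqI[of _ _ "i - 1"]) auto
  qed auto
  also have "card \<dots> = card {k. k < n \<and> f (int (Suc n)) < f (int (Suc k))}"
    by (intro card_image) simp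
  also have "\<dots> = (\<Sum>a\<leftarrow>window n f. if f (int (Suc n)) < a then 1 else 0)"
    by (simp add: window_def o_def sum_list_sum_nth atLeast0LessThan sum.If_cases Int_def)
  finally show ?case
    using Suc by (simp add: inv_num_def window_Suc word_inv_append if_distrib cong: if_cong)
qed

lemma maj_eq_word_maj: "maj n f = word_maj (window n f)"
proof (induction n)
  case 0
  then show ?case by (simp add: maj_def window_def)
next
  case (Suc n)
  show ?case
  proof (cases n)
    case 0
    have "{i. 1 \<le> i \<and> i < Suc 0 \<and> f (int i + 1) < f (int i)} = {}" by auto
    then show ?thesis by (simp add: maj_def window_def 0)
  next
    case n: (Suc m)
    let ?D = "\<lambda>m. {i. 1 \<le> i \<and> i < m \<and> f (int i + 1) < f (int i)}"
    have "?D (Suc n) = (if f (int n + 1) < f (int n) then insert n (?D n) else ?D n)"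
      using n by (auto simp: less_Suc_eq)
    then have "maj (Suc n) f = maj n f + (if f (int n + 1) < f (int n) then n else 0)"
      by (simp add: maj_def)
    moreover have "window (Suc n) f = window m f @ f (int n) # [f (int n + 1)]"
      by (simp add: n window_Suc)
    moreover have "window n f = window m f @ [f (int n)]"
      by (simp add: n window_Suc)
    ultimately show ?thesis
      using Suc n maj_from_append[of "Suc 0" "window m f" "f (int n)" "[f (int n + 1)]"] by simp
  qed
qed

lemma signed_perms_zero: "\<pi> \<in> signed_perms n \<Longrightarrow> \<pi> 0 = 0"
  by (auto simp: signed_perms_def permutes_def)

lemma window_abs_perm: "window n (abs_perm n \<pi>) = map abs (window n \<pi>)"
  by (auto simp: window_def abs_perm_def)

text \<open>Oddness and the values at \<open>1, \<dots>, n\<close> determine \<open>\<pi>\<close> on \<open>{\<plusminus>1, \<dots>, \<plusminus>n}\<close>. Conversely, the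
  odd extension of a word is injective because the absolute values of the letters are distinct.\<close>
lemma bij_betw_window: "bij_betw (window n) (signed_perms n) (signed_words n)"
proof (rule bij_betw_imageI)
  let ?S = "{- int n..int n} - {0}"
  show "inj_on (window n) (signed_perms n)"
  proof (rule inj_onI)
    fix \<pi> \<rho> assume \<pi>: "\<pi> \<in> signed_perms n" and \<rho>: "\<rho> \<in> signed_perms n"
      and eq: "window n \<pi> = window n \<rho>"
    have pos: "\<pi> i = \<rho> i" if "i \<in> {1..int n}" for i
    proof -
      have "nat i - 1 < n" "int (Suc (nat i - 1)) = i" using that by auto
      then show ?thesis using arg_cong[OF eq, of "\<lambda>w. w ! (nat i - 1)"] by simp
    qed
    show "\<pi> = \<rho>"
    proof
      fix i
      consider "i \<in> {1..int n}" | "- i \<in> {1..int n}" | "i \<notin> ?S" by force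
      then show "\<pi> i = \<rho> i"
      proof cases
        case 2
        then have "\<pi> (- (- i)) = \<rho> (- (- i))"
          using pos[of "- i"] \<pi> \<rho> by (simp only: signed_perms_def mem_Collect_eq)
        then show ?thesis by simp
      next
        case 3
        then have "\<pi> i = i" "\<rho> i = i"
          using \<pi> \<rho> unfolding signed_perms_def by (blast intro: permutes_not_in)+
        then show ?thesis by simp
      qed (rule pos)
    qed
  qed
  show "window n ` signed_perms n = signed_words n"
  proof (intro equalityI subsetI)
    fix w assume "w \<in> window n ` signed_perms n"
    then obtain \<pi> where w: "w = window n \<pi>" and perm: "\<pi> permutes ?S" and odd: "\<And>i. \<pi> (- i) = - \<pi> i"
      by (auto simp: signed_perms_def)
    have inj: "inj_on (\<lambda>k. \<bar>\<pi> (int k)\<bar>) {1..n}"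
    proof (rule inj_onI)
      fix i j assume ij: "i \<in> {1..n}" "j \<in> {1..n}" and "\<bar>\<pi> (int i)\<bar> = \<bar>\<pi> (int j)\<bar>"
      then have "\<pi> (int i) = \<pi> (int j) \<or> \<pi> (int i) = \<pi> (- int j)" by (auto simp: odd abs_eq_iff)
      then show "i = j" using permutes_inj[OF perm] ij by (auto simp: inj_eq)
    qed
    have "set (map abs w) = (\<lambda>k. \<bar>\<pi> (int k)\<bar>) ` {1..n}"
      by (simp add: w set_window image_image)
    moreover have "\<bar>\<pi> (int k)\<bar> \<in> {1..int n}" if "k \<in> {1..n}" for k
      using permutes_in_image[OF perm, of "int k"] that by auto
    ultimately have "set (map abs w) \<subseteq> {1..int n}" by auto
    moreover have card: "card (set (map abs w)) = n"
      using card_image[OF inj] \<open>set (map abs w) = _\<close> by simp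
    ultimately have "set (map abs w) = {1..int n}" by (intro card_subset_eq) auto
    moreover have "distinct (map abs w)" using card by (intro card_distinct) (simp add: w)
    ultimately show "w \<in> signed_words n" by (simp add: signed_words_def permutations_of_set_def)
  next
    fix w assume "w \<in> signed_words n"
    then have dist: "distinct (map abs w)" and set: "abs ` set w = {1..int n}"
      by (simp_all add: signed_words_def permutations_of_set_def)
    have len: "length w = n" using distinct_card[OF dist] set by simp
    have letter: "\<bar>w ! k\<bar> \<in> {1..int n}" if "k < n" for k
      using set nth_mem[of k w] that len by blast
    \<comment> \<open>the odd extension of the word\<close>
    define \<pi> where "\<pi> i = (if i \<in> ?S then sgn i * w ! (nat \<bar>i\<bar> - 1) else i)" for i
    have idx: "nat \<bar>i\<bar> - 1 < n" if "i \<in> ?S" for i using that by auto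
    have abs_\<pi>: "\<bar>\<pi> i\<bar> = \<bar>w ! (nat \<bar>i\<bar> - 1)\<bar>" if "i \<in> ?S" for i
      using that by (simp add: \<pi>_def abs_mult abs_sgn_eq)
    have "\<pi> ` ?S \<subseteq> ?S"
    proof
      fix j assume "j \<in> \<pi> ` ?S"
      then have "\<bar>j\<bar> \<in> {1..int n}" using abs_\<pi> letter idx by auto
      then show "j \<in> ?S" by auto
    qed
    moreover have "inj_on \<pi> ?S"
    proof (rule inj_onI)
      fix i j assume ij: "i \<in> ?S" "j \<in> ?S" and eq: "\<pi> i = \<pi> j"
      have "map abs w ! (nat \<bar>i\<bar> - 1) = map abs w ! (nat \<bar>j\<bar> - 1)"
        using abs_\<pi>[OF ij(1)] abs_\<pi>[OF ij(2)] eq idx ij len by simp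
      then have "nat \<bar>i\<bar> - 1 = nat \<bar>j\<bar> - 1"
        using nth_eq_iff_index_eq[OF dist] idx ij len by simp
      then have abs: "\<bar>i\<bar> = \<bar>j\<bar>" using ij by auto
      have "sgn i * w ! (nat \<bar>j\<bar> - 1) = sgn j * w ! (nat \<bar>j\<bar> - 1)"
        using eq unfolding \<pi>_def if_P[OF ij(1)] if_P[OF ij(2)] abs .
      moreover have "w ! (nat \<bar>j\<bar> - 1) \<noteq> 0" using letter[OF idx[OF ij(2)]] by auto
      ultimately have "sgn i = sgn j" by simp
      with abs show "i = j" by (metis mult_sgn_abs)
    qed
    ultimately have "bij_betw \<pi> ?S ?S"
      by (simp add: bij_betw_def endo_inj_surj)
    moreover have "\<pi> i = i" if "i \<notin> ?S" for i
      unfolding \<pi>_def using that by (rule if_not_P)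
    ultimately have "\<pi> permutes ?S" by (rule bij_imp_permutes)
    moreover have "\<pi> (- i) = - \<pi> i" for i by (auto simp: \<pi>_def sgn_minus)
    ultimately have "\<pi> \<in> signed_perms n" by (simp add: signed_perms_def)
    moreover have "window n \<pi> = w"
      by (rule nth_equalityI) (auto simp: len \<pi>_def nat_add_distrib)
    ultimately show "w \<in> window n ` signed_perms n" by blast
  qed
qed

lemma window_in_signed_words: "\<pi> \<in> signed_perms n \<Longrightarrow> window n \<pi> \<in> signed_words n"
  using bij_betw_window by (rule bij_betwE[THEN bspec])

lemma bij_betw_Neg_neg_letters:
  assumes "\<pi> \<in> signed_perms n"
  shows "bij_betw (\<lambda>i. nat (- \<pi> (int i))) (Neg n \<pi>) (neg_letters (window n \<pi>))"
proof -
  have inj: "inj \<pi>" using assms by (auto simp: signed_perms_def permutes_inj)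
  show ?thesis
  proof (rule bij_betw_imageI)
    show "inj_on (\<lambda>i. nat (- \<pi> (int i))) (Neg n \<pi>)"
    proof (rule inj_onI)
      fix i j assume "i \<in> Neg n \<pi>" "j \<in> Neg n \<pi>" "nat (- \<pi> (int i)) = nat (- \<pi> (int j))"
      then have "\<pi> (int i) = \<pi> (int j)" by (auto simp: Neg_def)
      then show "i = j" using injD[OF inj, of "int i" "int j"] by simp
    qed
    show "(\<lambda>i. nat (- \<pi> (int i))) ` Neg n \<pi> = neg_letters (window n \<pi>)"
    proof (intro equalityI subsetI)
      fix k assume "k \<in> neg_letters (window n \<pi>)"
      then obtain i where "i \<in> {1..n}" "- int k = \<pi> (int i)" "k \<noteq> 0"
        by (auto simp: neg_letters_def set_window)
      then have "i \<in> Neg n \<pi>" "k = nat (- \<pi> (int i))" by (auto simp: Neg_def)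
      then show "k \<in> (\<lambda>i. nat (- \<pi> (int i))) ` Neg n \<pi>" by blast
    qed (force simp: neg_letters_def set_window Neg_def)
  qed
qed

lemma neg_eq_card_neg_letters:
  "\<pi> \<in> signed_perms n \<Longrightarrow> neg n \<pi> = card (neg_letters (window n \<pi>))"
  unfolding neg_def by (rule bij_betw_same_card[OF bij_betw_Neg_neg_letters])

lemma nmaj_eq:
  assumes "\<pi> \<in> signed_perms n"
  shows "nmaj n \<pi> = word_maj (window n \<pi>) + \<Sum>(neg_letters (window n \<pi>))"
proof -
  have "- (\<Sum>i\<in>Neg n \<pi>. \<pi> (int i)) = (\<Sum>i\<in>Neg n \<pi>. int (nat (- \<pi> (int i))))"
    by (subst sum_negf[symmetric], rule sum.cong) (auto simp: Neg_def)
  also have "\<dots> = int (\<Sum>(neg_letters (window n \<pi>)))"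
    using sum.reindex_bij_betw[OF bij_betw_Neg_neg_letters[OF assms], of int] by (simp only: of_nat_sum)
  finally have "int (maj n \<pi>) - (\<Sum>i\<in>Neg n \<pi>. \<pi> (int i)) =
      int (word_maj (window n \<pi>) + \<Sum>(neg_letters (window n \<pi>)))"
    by (simp only: of_nat_add diff_conv_add_uminus maj_eq_word_maj)
  then show ?thesis by (simp only: nmaj_def nat_int)
qed

section \<open>Inversions of a word and of its absolute values\<close>

text \<open>A pair of letters is ordered differently by value and by absolute value exactly when the one of
  larger absolute value, here \<open>c\<close>, is negative. The sum counts these pairs, independently of the
  order of the letters in \<open>w\<close>.\<close>
lemma parity_word_inv_abs:
  fixes w :: "int list"
  assumes "distinct (map abs w)"
  shows "even (word_inv (map abs w) + word_inv w +
    (\<Sum>c\<in>{c \<in> set w. c < 0}. card {b \<in> set w. \<bar>b\<bar> < \<bar>c\<bar>}))"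
  using assms
proof (induction w)
  case Nil
  then show ?case by simp
next
  case (Cons a w)
  let ?S = "set w" and ?neg = "{c \<in> set w. c < 0}"
  have dist: "distinct w" "a \<notin> ?S" and "\<bar>a\<bar> \<notin> abs ` ?S"
    using Cons.prems by (auto simp: distinct_map)
  then have abs: "\<bar>b\<bar> \<noteq> \<bar>a\<bar>" if "b \<in> ?S" for b using that by (metis imageI)
  define small where "small = card {b \<in> ?S. \<bar>b\<bar> < \<bar>a\<bar>}"
  define large where "large = card {c \<in> ?S. c < 0 \<and> \<bar>a\<bar> < \<bar>c\<bar>}"
  \<comment> \<open>\<open>small\<close> and \<open>large\<close> count the partners \<open>b\<close> of the new letter \<open>a\<close> by which of the two has
    the larger absolute value; in \<open>large\<close> only negative \<open>b\<close> matter.\<close>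
  have inv: "word_inv (a # w) = word_inv w + large + (if a < 0 then 0 else small)"
  proof -
    have "card {b \<in> ?S. b < a} = large + (if a < 0 then 0 else small)"
    proof (cases "a < 0")
      case True
      then have "{b \<in> ?S. b < a} = {c \<in> ?S. c < 0 \<and> \<bar>a\<bar> < \<bar>c\<bar>}" by auto
      then show ?thesis using True by (simp add: large_def)
    next
      case False
      have "b < a \<longleftrightarrow> b < 0 \<and> \<bar>a\<bar> < \<bar>b\<bar> \<or> \<bar>b\<bar> < \<bar>a\<bar>" if "b \<in> ?S" for b
        using False abs[OF that] by linarith
      then have "{b \<in> ?S. b < a} = {c \<in> ?S. c < 0 \<and> \<bar>a\<bar> < \<bar>c\<bar>} \<union> {b \<in> ?S. \<bar>b\<bar> < \<bar>a\<bar>}"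
        by blast
      moreover have "card \<dots> = large + small"
        unfolding large_def small_def by (intro card_Un_disjoint) auto
      ultimately show ?thesis using False by simp
    qed
    then show ?thesis using dist(1) by (simp add: length_filter_distinct)
  qed
  have inv_abs: "word_inv (map abs (a # w)) = word_inv (map abs w) + small"
    using dist(1) by (simp add: filter_map o_def length_filter_distinct small_def)
  have card_insert: "card {b \<in> insert a ?S. \<bar>b\<bar> < \<bar>c\<bar>} =
      card {b \<in> ?S. \<bar>b\<bar> < \<bar>c\<bar>} + (if \<bar>a\<bar> < \<bar>c\<bar> then 1 else 0)" for c
  proof -
    have "{b \<in> insert a ?S. \<bar>b\<bar> < \<bar>c\<bar>} =
        (if \<bar>a\<bar> < \<bar>c\<bar> then insert a {b \<in> ?S. \<bar>b\<bar> < \<bar>c\<bar>} else {b \<in> ?S. \<bar>b\<bar> < \<bar>c\<bar>})" by auto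
    then show ?thesis using dist(2) by simp
  qed
  have "(\<Sum>c\<in>?neg. if \<bar>a\<bar> < \<bar>c\<bar> then 1 else 0) = card (?neg \<inter> {c. \<bar>a\<bar> < \<bar>c\<bar>})"
    by (subst sum.If_cases) simp_all
  also have "?neg \<inter> {c. \<bar>a\<bar> < \<bar>c\<bar>} = {c \<in> ?S. c < 0 \<and> \<bar>a\<bar> < \<bar>c\<bar>}" by auto
  finally have "(\<Sum>c\<in>?neg. if \<bar>a\<bar> < \<bar>c\<bar> then 1 else 0) = large" by (simp only: large_def)
  then have old: "(\<Sum>c\<in>?neg. card {b \<in> insert a ?S. \<bar>b\<bar> < \<bar>c\<bar>}) =
      (\<Sum>c\<in>?neg. card {b \<in> ?S. \<bar>b\<bar> < \<bar>c\<bar>}) + large"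
    by (simp only: card_insert sum.distrib)
  have insert_neg: "(\<Sum>c\<in>{c \<in> insert a ?S. c < 0}. f c) = (\<Sum>c\<in>?neg. f c) + (if a < 0 then f a else 0)"
    for f :: "int \<Rightarrow> nat"
  proof -
    have "{c \<in> insert a ?S. c < 0} = (if a < 0 then insert a ?neg else ?neg)" by auto
    then show ?thesis using dist(2) by simp
  qed
  let ?pairs = "\<Sum>c\<in>?neg. card {b \<in> ?S. \<bar>b\<bar> < \<bar>c\<bar>}"
  have arith: "i + small + (j + large + u) + s = i + j + t + 2 * (large + small)"
    if "s = t + large + v" "u + v = small" for i j s t u v :: nat
    using that by simp
  have "(\<Sum>c\<in>{c \<in> insert a ?S. c < 0}. card {b \<in> insert a ?S. \<bar>b\<bar> < \<bar>c\<bar>}) =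
      ?pairs + large + (if a < 0 then small else 0)"
    unfolding insert_neg old card_insert[of a] by (simp add: small_def)
  then have "word_inv (map abs (a # w)) + word_inv (a # w) +
      (\<Sum>c\<in>{c \<in> set (a # w). c < 0}. card {b \<in> set (a # w). \<bar>b\<bar> < \<bar>c\<bar>}) =
      word_inv (map abs w) + word_inv w + ?pairs + 2 * (large + small)"
    unfolding inv inv_abs list.set by (rule arith) simp
  moreover have "even (word_inv (map abs w) + word_inv w + ?pairs)"
    by (rule Cons.IH) (use Cons.prems in simp)
  ultimately show ?case by (simp only: dvd_add dvd_triv_left)
qed

lemma parity_inv_num_abs_perm:
  assumes "\<pi> \<in> signed_perms n"
  shows "even (inv_num n (abs_perm n \<pi>) + word_inv (window n \<pi>) + (\<Sum>k\<in>neg_letters (window n \<pi>). k - 1))"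
proof -
  let ?w = "window n \<pi>"
  have w: "distinct (map abs ?w)" and abs: "abs ` set ?w = {1..int n}"
    using window_in_signed_words[OF assms] by (simp_all add: signed_words_def permutations_of_set_def)
  have inj: "inj_on abs (set ?w)" using w by (simp add: distinct_map)
  have card: "card {b \<in> set ?w. \<bar>b\<bar> < int k} = k - 1" if k: "k \<in> neg_letters ?w" for k
  proof -
    have "\<bar>- int k\<bar> \<in> abs ` set ?w" using k by (intro imageI) (simp add: neg_letters_def)
    then have "int k \<le> int n" unfolding abs by simp
    have "abs ` {b \<in> set ?w. \<bar>b\<bar> < int k} = {c \<in> abs ` set ?w. c < int k}" by auto
    also have "\<dots> = {1..<int k}" unfolding abs using \<open>int k \<le> int n\<close> by auto
    finally have "card (abs ` {b \<in> set ?w. \<bar>b\<bar> < int k}) = k - 1" by simp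
    then show ?thesis
      using card_image[OF inj_on_subset[OF inj], of "{b \<in> set ?w. \<bar>b\<bar> < int k}"] by simp
  qed
  have "bij_betw (\<lambda>k. - int k) (neg_letters ?w) {c \<in> set ?w. c < 0}"
    by (rule bij_betw_byWitness[where f' = "\<lambda>c. nat (- c)"]) (auto simp: neg_letters_def)
  then have "(\<Sum>c\<in>{c \<in> set ?w. c < 0}. card {b \<in> set ?w. \<bar>b\<bar> < \<bar>c\<bar>}) = (\<Sum>k\<in>neg_letters ?w. k - 1)"
    by (subst sum.reindex_bij_betw[symmetric]) (auto simp: card intro!: sum.cong)
  then show ?thesis
    using parity_word_inv_abs[OF w] by (simp add: inv_num_eq_word_inv window_abs_perm)
qed

section \<open>The Coxeter length\<close>

text \<open>The combinatorial formula for the Coxeter length, in terms of the window.\<close>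
definition length_word :: "int list \<Rightarrow> nat" where
  "length_word w = word_inv w + \<Sum>(neg_letters w)"

lemma finite_neg_letters [simp]: "finite (neg_letters w)"
proof -
  have "neg_letters w \<subseteq> (\<lambda>a. nat (- a)) ` set w" by (force simp: neg_letters_def)
  then show ?thesis by (rule finite_subset) simp
qed

lemma length_word_swap:
  assumes "a < b"
  shows "length_word (u @ b # a # v) = Suc (length_word (u @ a # b # v))"
proof -
  have "neg_letters (u @ b # a # v) = neg_letters (u @ a # b # v)"
    by (auto simp: neg_letters_def)
  moreover have "(\<Sum>c\<leftarrow>u. length (filter (\<lambda>x. x < c) (b # a # v))) =
      (\<Sum>c\<leftarrow>u. length (filter (\<lambda>x. x < c) (a # b # v)))"
    by (intro arg_cong[of _ _ sum_list] map_cong refl) simp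
  ultimately show ?thesis
    using assms less_not_sym[OF assms] by (simp add: length_word_def word_inv_append)
qed

text \<open>The sum of the absolute values of the negative letters grows by \<open>a\<close>. The inversions lost are those with the letters of
  absolute value less than \<open>a\<close>, of which there are \<open>a - 1\<close>, because the absolute values of the letters
  fill \<open>{1, \<dots>, n}\<close>.\<close>
lemma length_word_negate_first:
  assumes "0 < a" and w: "a # w \<in> signed_words n"
  shows "length_word (- a # w) = Suc (length_word (a # w))"
proof -
  have dist: "distinct w" and inj: "inj_on abs (set w)" and a: "a \<notin> abs ` set w"
    and abs: "insert a (abs ` set w) = {1..int n}"
    using w \<open>0 < a\<close> by (auto simp: signed_words_def permutations_of_set_def distinct_map)
  have "- a \<notin> set w" using a \<open>0 < a\<close> by (force simp: image_iff)
  have "neg_letters (- a # w) = insert (nat a) (neg_letters (a # w))"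
    using \<open>0 < a\<close> by (auto simp: neg_letters_def)
  moreover have "nat a \<notin> neg_letters (a # w)"
    using \<open>- a \<notin> set w\<close> \<open>0 < a\<close> by (auto simp: neg_letters_def)
  ultimately have sum: "\<Sum>(neg_letters (- a # w)) = nat a + \<Sum>(neg_letters (a # w))"
    by simp
  have "abs ` {b \<in> set w. \<bar>b\<bar> < a} = {c \<in> insert a (abs ` set w). c < a}" by auto
  also have "\<dots> = {1..<a}"
  proof -
    have "a \<in> {1..int n}" using abs by blast
    then show ?thesis unfolding abs by auto
  qed
  finally have "card {b \<in> set w. \<bar>b\<bar> < a} = card {1..<a}"
    using card_image[OF inj_on_subset[OF inj], of "{b \<in> set w. \<bar>b\<bar> < a}"] by simp
  then have small: "card {b \<in> set w. \<bar>b\<bar> < a} = nat a - 1" by simp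
  \<comment> \<open>Neither \<open>a\<close> nor \<open>- a\<close> occurs in \<open>w\<close>, so the letters below \<open>a\<close> are those below \<open>- a\<close>
    and those strictly between \<open>- a\<close> and \<open>a\<close>.\<close>
  have "{b \<in> set w. b < a} = {b \<in> set w. b < - a} \<union> {b \<in> set w. \<bar>b\<bar> < a}"
  proof -
    have "b < a \<longleftrightarrow> b < - a \<or> \<bar>b\<bar> < a" if "b \<in> set w" for b
      using \<open>0 < a\<close> \<open>- a \<notin> set w\<close> that by (cases "b = - a") auto
    then show ?thesis by blast
  qed
  moreover have "card \<dots> = card {b \<in> set w. b < - a} + (nat a - 1)"
    unfolding small[symmetric] by (intro card_Un_disjoint) auto
  ultimately have "word_inv (a # w) = word_inv (- a # w) + (nat a - 1)"
    using dist by (simp add: length_filter_distinct)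
  with sum show ?thesis using \<open>0 < a\<close> by (simp add: length_word_def)
qed

lemma signed_perms_comp:
  "\<pi> \<in> signed_perms n \<Longrightarrow> \<rho> \<in> signed_perms n \<Longrightarrow> \<pi> \<circ> \<rho> \<in> signed_perms n"
  by (auto simp: signed_perms_def intro: permutes_compose)

lemma gen_B_in_signed_perms:
  assumes "i < n"
  shows "gen_B i \<in> signed_perms n"
proof -
  have "gen_B i permutes ({- int n..int n} - {0})"
    using assms unfolding gen_B_def by (auto intro!: permutes_compose permutes_swap_id)
  moreover have "gen_B i (- j) = - gen_B i j" for j
    by (auto simp: gen_B_def transpose_def)
  ultimately show ?thesis by (simp add: signed_perms_def)
qed

lemma gen_B_gen_B: "gen_B i \<circ> gen_B i = id"
  by (auto simp: gen_B_def transpose_def fun_eq_iff)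

lemma comp_gen_B_gen_B: "\<pi> \<circ> gen_B i \<circ> gen_B i = \<pi>"
  by (simp add: comp_assoc gen_B_gen_B)

text \<open>Right multiplication by \<open>s\<^sub>i\<close> exchanges the letters at positions \<open>i\<close> and \<open>i + 1\<close>, and \<open>s\<^sub>0\<close>
  negates the first letter. Since \<open>\<pi> 0 = 0\<close>, an ascent at \<open>0\<close> means that the first letter is
  positive, so both kinds of generators are covered by the same condition.\<close>
lemma length_word_comp_gen_B_ascent:
  assumes \<pi>: "\<pi> \<in> signed_perms n" and "i < n" and ascent: "\<pi> (int i) < \<pi> (int (Suc i))"
  shows "length_word (window n (\<pi> \<circ> gen_B i)) = Suc (length_word (window n \<pi>))"
proof (cases i)
  case 0
  have odd: "\<pi> (- 1) = - \<pi> 1" using \<pi> by (simp add: signed_perms_def)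
  obtain m where n: "n = Suc m" using \<open>i < n\<close> by (cases n) auto
  define v where "v = map (\<lambda>k. \<pi> (int (Suc (Suc k)))) [0..<m]"
  have upt: "[0..<n] = 0 # map Suc [0..<m]" unfolding n map_Suc_upt by (simp add: upt_conv_Cons del: upt_Suc)
  have win: "window n \<pi> = \<pi> 1 # v"
    by (simp add: window_def v_def upt)
  have "window n (\<pi> \<circ> gen_B i) = - \<pi> 1 # v"
    by (auto simp: window_def v_def upt 0 gen_B_def transpose_def odd)
  then show ?thesis
    using length_word_negate_first[of "\<pi> 1" v n] window_in_signed_words[OF \<pi>] ascent 0
      signed_perms_zero[OF \<pi>] by (simp add: win)
next
  case (Suc j)
  let ?w = "window n \<pi>" and ?a = "\<pi> (int i)" and ?b = "\<pi> (int (Suc i))"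
  have split: "?w = take j ?w @ ?a # ?b # drop (Suc i) ?w"
    using \<open>i < n\<close> Suc id_take_nth_drop[of j ?w] Cons_nth_drop_Suc[of i ?w] by simp
  have "window n (\<pi> \<circ> gen_B i) = take j ?w @ ?b # ?a # drop (Suc i) ?w"
  proof (rule nth_equalityI)
    fix k assume "k < length (window n (\<pi> \<circ> gen_B i))"
    then have "k < n" by simp
    then consider "k < j" | "k = j" | "k = i" | "i < k" using Suc by linarith
    then show "window n (\<pi> \<circ> gen_B i) ! k = (take j ?w @ ?b # ?a # drop (Suc i) ?w) ! k"
      by cases (use \<open>k < n\<close> \<open>i < n\<close> Suc in
        \<open>auto simp: nth_append nth_Cons' gen_B_def transpose_def min_def\<close>)
  qed (use \<open>i < n\<close> Suc in simp)
  then show ?thesis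
    using length_word_swap[OF ascent, of "take j ?w" "drop (Suc i) ?w"] split by (simp only:)
qed

text \<open>Multiplication by \<open>s\<^sub>i\<close> turns a descent at \<open>i\<close> into an ascent, and \<open>s\<^sub>i\<close> is an
  involution, so the ascent case applies to \<open>\<pi> s\<^sub>i\<close>.\<close>
lemma length_word_comp_gen_B_descent:
  assumes \<pi>: "\<pi> \<in> signed_perms n" and "i < n" and descent: "\<pi> (int (Suc i)) < \<pi> (int i)"
  shows "length_word (window n \<pi>) = Suc (length_word (window n (\<pi> \<circ> gen_B i)))"
proof -
  let ?\<rho> = "\<pi> \<circ> gen_B i"
  have "?\<rho> \<in> signed_perms n" by (intro signed_perms_comp \<pi> gen_B_in_signed_perms \<open>i < n\<close>)
  moreover have "?\<rho> (int i) < ?\<rho> (int (Suc i))"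
  proof (cases i)
    case 0
    have "\<pi> (- 1) = - \<pi> 1" using \<pi> by (simp add: signed_perms_def)
    then show ?thesis using descent signed_perms_zero[OF \<pi>] 0 by (simp add: gen_B_def transpose_def)
  next
    case (Suc j)
    then show ?thesis using descent by (simp add: gen_B_def transpose_def add.commute)
  qed
  ultimately show ?thesis
    using length_word_comp_gen_B_ascent[of ?\<rho> n i] \<open>i < n\<close> by (simp add: comp_gen_B_gen_B)
qed

text \<open>Without descents the integers \<open>0 = \<pi> 0 < \<pi> 1 < \<dots> < \<pi> n\<close> are bounded by \<open>n\<close>, which
  leaves only \<open>\<pi> k = k\<close>.\<close>
lemma no_descent_imp_id:
  assumes \<pi>: "\<pi> \<in> signed_perms n" and ascent: "\<And>i. i < n \<Longrightarrow> \<pi> (int i) < \<pi> (int (Suc i))"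
  shows "\<pi> = id"
proof -
  let ?S = "{- int n..int n} - {0}"
  have perm: "\<pi> permutes ?S" and odd: "\<And>i. \<pi> (- i) = - \<pi> i"
    using \<pi> by (auto simp: signed_perms_def)
  have lower: "int k \<le> \<pi> (int k)" if "k \<le> n" for k
    using that
  proof (induction k)
    case (Suc k)
    then show ?case using ascent[of k] by simp
  qed (simp add: signed_perms_zero[OF \<pi>])
  have upper: "\<pi> (int k) \<le> int k" if "k \<le> n" for k
    using that
  proof (induction rule: inc_induct)
    case base
    show ?case using permutes_in_image[OF perm, of "int n"] signed_perms_zero[OF \<pi>] by (cases "n = 0") auto
  next
    case (step k)
    then show ?case using ascent[of k] by simp
  qed
  have pos: "\<pi> (int k) = int k" if "k \<le> n" for k
    using lower[OF that] upper[OF that] by simp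
  show "\<pi> = id"
  proof
    fix i
    show "\<pi> i = id i"
    proof (cases "i \<in> ?S")
      case True
      then have "\<pi> (int (nat \<bar>i\<bar>)) = int (nat \<bar>i\<bar>)" by (intro pos) auto
      then show ?thesis using odd[of i] by (cases "i < 0") auto
    next
      case False
      then show ?thesis using permutes_not_in[OF perm] by simp
    qed
  qed
qed

lemma length_word_id: "length_word (window n id) = 0"
proof -
  have "neg_letters (window n id) = {}" by (auto simp: neg_letters_def set_window)
  moreover have "inv_num n id = card ({} :: (nat \<times> nat) set)"
    unfolding inv_num_def by (rule arg_cong[of _ _ card]) auto
  ultimately show ?thesis by (simp add: length_word_def flip: inv_num_eq_word_inv)
qed

lemma foldr_comp_snoc: "foldr (\<circ>) (fs @ [f]) id = foldr (\<circ>) fs id \<circ> f"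
  by (induction fs) (auto simp: comp_assoc)

text \<open>Each generator raises \<open>length_word\<close> by at most one, starting from 0 at the identity. Membership in
  \<open>signed_perms\<close> is carried along for the induction.\<close>
lemma length_word_le_length:
  assumes "set ws \<subseteq> {0..<n}"
  shows "foldr (\<circ>) (map gen_B ws) id \<in> signed_perms n \<and>
    length_word (window n (foldr (\<circ>) (map gen_B ws) id)) \<le> length ws"
  using assms
proof (induction ws rule: rev_induct)
  case Nil
  have "id \<in> signed_perms n" by (simp add: signed_perms_def permutes_id)
  then show ?case using length_word_id by (simp add: id_def)
next
  case (snoc i ws)
  let ?\<rho> = "foldr (\<circ>) (map gen_B ws) id"
  have i: "i < n" and "set ws \<subseteq> {0..<n}" using snoc.prems by auto
  then have \<rho>: "?\<rho> \<in> signed_perms n" and le: "length_word (window n ?\<rho>) \<le> length ws"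
    using snoc.IH by blast+
  have "inj ?\<rho>" using \<rho> by (auto simp: signed_perms_def permutes_inj)
  then have "?\<rho> (int i) \<noteq> ?\<rho> (int (Suc i))" by (simp add: inj_eq del: of_nat_Suc)
  then consider "?\<rho> (int i) < ?\<rho> (int (Suc i))" | "?\<rho> (int (Suc i)) < ?\<rho> (int i)"
    by (rule linorder_neqE)
  then have "length_word (window n (?\<rho> \<circ> gen_B i)) \<le> Suc (length_word (window n ?\<rho>))"
  proof cases
    case 1
    show ?thesis by (simp only: length_word_comp_gen_B_ascent[OF \<rho> i 1])
  next
    case 2
    show ?thesis by (simp only: length_word_comp_gen_B_descent[OF \<rho> i 2])
  qed
  moreover have "foldr (\<circ>) (map gen_B (ws @ [i])) id = ?\<rho> \<circ> gen_B i"
    unfolding map_append list.map by (rule foldr_comp_snoc)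
  ultimately show ?case
    using le signed_perms_comp[OF \<rho> gen_B_in_signed_perms[OF i]] by (simp only: simp_thms length_append_singleton)
qed

text \<open>While \<open>\<pi>\<close> is not the identity, it has a descent, and multiplying by the corresponding generator
  lowers \<open>length_word\<close> by one.\<close>
lemma ex_word_of_length:
  assumes "\<pi> \<in> signed_perms n"
  shows "\<exists>ws. length ws = length_word (window n \<pi>) \<and> set ws \<subseteq> {0..<n} \<and>
    \<pi> = foldr (\<circ>) (map gen_B ws) id"
  using assms
proof (induction "length_word (window n \<pi>)" arbitrary: \<pi>)
  case 0
  have "\<pi> = id"
  proof (rule no_descent_imp_id[OF \<open>\<pi> \<in> signed_perms n\<close>])
    fix i assume "i < n"
    have "inj \<pi>" using 0 by (auto simp: signed_perms_def permutes_inj)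
    then have "\<pi> (int i) \<noteq> \<pi> (int (Suc i))" by (simp add: inj_eq del: of_nat_Suc)
    then show "\<pi> (int i) < \<pi> (int (Suc i))"
      using length_word_comp_gen_B_descent[OF 0(2) \<open>i < n\<close>] 0(1) by linarith
  qed
  then show ?case using length_word_id by (intro exI[of _ "[]"]) (simp add: id_def)
next
  case (Suc m)
  have "\<pi> \<noteq> id" using Suc(2) by (auto simp: length_word_id)
  then obtain i where i: "i < n" "\<not> \<pi> (int i) < \<pi> (int (Suc i))"
    using no_descent_imp_id[OF Suc(3)] by blast
  have "inj \<pi>" using Suc(3) by (auto simp: signed_perms_def permutes_inj)
  then have "\<pi> (int i) \<noteq> \<pi> (int (Suc i))" by (simp add: inj_eq del: of_nat_Suc)
  with i have "\<pi> (int (Suc i)) < \<pi> (int i)" by linarith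
  then have step: "length_word (window n \<pi>) = Suc (length_word (window n (\<pi> \<circ> gen_B i)))"
    by (rule length_word_comp_gen_B_descent[OF Suc(3) i(1)])
  have "\<pi> \<circ> gen_B i \<in> signed_perms n"
    by (intro signed_perms_comp Suc(3) gen_B_in_signed_perms i(1))
  moreover have "m = length_word (window n (\<pi> \<circ> gen_B i))" using step Suc(2) by simp
  ultimately obtain ws where ws: "length ws = m" "set ws \<subseteq> {0..<n}"
      "\<pi> \<circ> gen_B i = foldr (\<circ>) (map gen_B ws) id"
    using Suc(1)[of "\<pi> \<circ> gen_B i"] by auto
  have "\<pi> = \<pi> \<circ> gen_B i \<circ> gen_B i" by (simp only: comp_gen_B_gen_B)
  also have "\<dots> = foldr (\<circ>) (map gen_B (ws @ [i])) id"
    unfolding ws(3) map_append list.map by (rule foldr_comp_snoc[symmetric])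
  finally show ?case using ws i(1) Suc(2) by (intro exI[of _ "ws @ [i]"]) simp
qed

theorem length_B_eq:
  assumes "\<pi> \<in> signed_perms n"
  shows "length_B n \<pi> = word_inv (window n \<pi>) + \<Sum>(neg_letters (window n \<pi>))"
proof -
  have "length_B n \<pi> = length_word (window n \<pi>)"
    unfolding length_B_def
  proof (rule Least_equality)
    show "\<exists>ws. length ws = length_word (window n \<pi>) \<and> set ws \<subseteq> {0..<n} \<and>
        \<pi> = foldr (\<circ>) (map gen_B ws) id"
      by (rule ex_word_of_length[OF assms])
  next
    fix k assume "\<exists>ws. length ws = k \<and> set ws \<subseteq> {0..<n} \<and> \<pi> = foldr (\<circ>) (map gen_B ws) id"
    then show "length_word (window n \<pi>) \<le> k" using length_word_le_length by blast
  qed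
  then show ?thesis by (simp only: length_word_def)
qed

section \<open>Summing over the sets of negative letters\<close>

lemma q_bracket_2: "q_bracket 2 p = 1 + p"
  by (simp add: q_bracket_def numeral_2_eq_2)

definition signed_letters :: "nat \<Rightarrow> nat set \<Rightarrow> int set" where
  "signed_letters n N = (\<lambda>k. if k \<in> N then - int k else int k) ` {1..n}"

lemma card_signed_letters: "card (signed_letters n N) = n"
proof -
  have "inj_on (\<lambda>k. if k \<in> N then - int k else int k) {1..n}"
    by (auto simp: inj_on_def split: if_splits)
  then show ?thesis by (simp only: signed_letters_def card_image) simp
qed

lemma finite_signed_letters [simp]: "finite (signed_letters n N)"
  by (simp add: signed_letters_def)

lemma neg_letters_eq:
  assumes "N \<subseteq> {1..n}" "w \<in> permutations_of_set (signed_letters n N)"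
  shows "neg_letters w = N"
proof -
  have "set w = signed_letters n N" using assms(2) by (simp add: permutations_of_set_def)
  moreover have "- int k \<in> signed_letters n N \<longleftrightarrow> k \<in> N" if "k \<noteq> 0" for k
    using assms(1) that by (force simp: signed_letters_def split: if_splits)
  moreover have "0 \<notin> N" using assms(1) by auto
  ultimately show ?thesis unfolding neg_letters_def by (intro set_eqI) (metis (mono_tags, lifting) mem_Collect_eq)
qed

text \<open>Since the absolute values of the letters of a signed word are distinct, its letters are known
  once the absolute values of the negative ones are.\<close>
lemma signed_words_eq_Union:
  "signed_words n = (\<Union>N\<in>Pow {1..n}. permutations_of_set (signed_letters n N))"
proof (intro equalityI subsetI)
  fix w assume "w \<in> signed_words n"
  then have dist: "distinct w" and inj: "inj_on abs (set w)" and abs: "abs ` set w = {1..int n}"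
    by (auto simp: signed_words_def permutations_of_set_def distinct_map)
  have bound: "\<bar>a\<bar> \<in> {1..int n}" if "a \<in> set w" for a using abs that by blast
  have "neg_letters w \<in> Pow {1..n}"
  proof -
    have "k \<in> {1..n}" if "k \<in> neg_letters w" for k
      using that bound[of "- int k"] by (auto simp: neg_letters_def)
    then show ?thesis by blast
  qed
  moreover have "set w = signed_letters n (neg_letters w)"
  proof (intro equalityI subsetI)
    fix a assume a: "a \<in> set w"
    have "a = (if nat \<bar>a\<bar> \<in> neg_letters w then - int (nat \<bar>a\<bar>) else int (nat \<bar>a\<bar>))"
    proof (cases "a < 0")
      case True
      then show ?thesis using a by (simp add: neg_letters_def)
    next
      case False
      have "- a \<notin> set w" using inj_onD[OF inj _ a, of "- a"] bound[OF a] by auto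
      then show ?thesis using False by (simp add: neg_letters_def)
    qed
    moreover have "nat \<bar>a\<bar> \<in> {1..n}" using bound[OF a] by auto
    ultimately show "a \<in> signed_letters n (neg_letters w)" unfolding signed_letters_def by blast
  next
    fix a assume "a \<in> signed_letters n (neg_letters w)"
    then obtain k where k: "k \<in> {1..n}" "a = (if k \<in> neg_letters w then - int k else int k)"
      by (auto simp: signed_letters_def)
    have "int k \<in> abs ` set w" using k(1) abs by simp
    then obtain b where "b \<in> set w" "int k = \<bar>b\<bar>" by blast
    then have "int k \<in> set w \<or> - int k \<in> set w" by (cases "b < 0") auto
    then show "a \<in> set w" using k by (auto simp: neg_letters_def split: if_splits)
  qed
  ultimately show "w \<in> (\<Union>N\<in>Pow {1..n}. permutations_of_set (signed_letters n N))"
    using dist by (auto simp: permutations_of_set_def)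
next
  fix w assume "w \<in> (\<Union>N\<in>Pow {1..n}. permutations_of_set (signed_letters n N))"
  then obtain N where w: "set w = signed_letters n N" "distinct w" by (auto simp: permutations_of_set_def)
  have "abs ` signed_letters n N = int ` {1..n}" unfolding signed_letters_def image_image by (rule image_cong) auto
  moreover have "inj_on abs (signed_letters n N)" by (auto simp: inj_on_def signed_letters_def split: if_splits)
  ultimately show "w \<in> signed_words n"
    using w by (simp add: signed_words_def permutations_of_set_def distinct_map image_int_atLeastAtMost)
qed

lemma sum_signed_words:
  "(\<Sum>w\<in>signed_words n. F w) = (\<Sum>N\<in>Pow {1..n}. \<Sum>w\<in>permutations_of_set (signed_letters n N). F w)"
  unfolding signed_words_eq_Union
proof (rule sum.UNION_disjoint)
  show "\<forall>N\<in>Pow {1..n}. \<forall>M\<in>Pow {1..n}. N \<noteq> M \<longrightarrow>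
      permutations_of_set (signed_letters n N) \<inter> permutations_of_set (signed_letters n M) = {}"
    using neg_letters_eq by (metis (no_types, lifting) Pow_iff disjoint_iff)
qed auto

text \<open>The inner sum over the arrangements does not depend on \<open>N\<close>, so it factors out, and the sum over
  all subsets \<open>N\<close> of the products \<open>\<Prod>k\<in>N. y k\<close> is an expanded product.\<close>
theorem sum_signed_words_weighted:
  fixes y :: "nat \<Rightarrow> 'b::comm_ring_1"
  assumes "\<And>N. N \<subseteq> {1..n} \<Longrightarrow> (\<Sum>w\<in>permutations_of_set (signed_letters n N). G w) = (\<Prod>k=1..n. g k)"
  shows "(\<Sum>w\<in>signed_words n. (\<Prod>k\<in>neg_letters w. y k) * G w) = (\<Prod>k=1..n. q_bracket 2 (y k) * g k)"
proof -
  have "(\<Sum>w\<in>signed_words n. (\<Prod>k\<in>neg_letters w. y k) * G w) =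
      (\<Sum>N\<in>Pow {1..n}. \<Sum>w\<in>permutations_of_set (signed_letters n N). (\<Prod>k\<in>N. y k) * G w)"
    unfolding sum_signed_words by (intro sum.cong refl) (simp add: neg_letters_eq)
  also have "\<dots> = (\<Sum>N\<in>Pow {1..n}. (\<Prod>k\<in>N. y k) * (\<Prod>k=1..n. g k))"
    by (intro sum.cong refl) (simp add: assms flip: sum_distrib_left)
  also have "\<dots> = (\<Prod>k=1..n. y k + 1) * (\<Prod>k=1..n. g k)"
    by (simp add: prod_add sum_distrib_right)
  also have "\<dots> = (\<Prod>k=1..n. q_bracket 2 (y k) * g k)"
    by (simp add: q_bracket_2 prod.distrib add.commute)
  finally show ?thesis .
qed

theorem sum_signed_perms_weighted:
  fixes y :: "nat \<Rightarrow> 'b::comm_ring_1"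
  assumes "\<And>A. finite A \<Longrightarrow> (\<Sum>w\<in>permutations_of_set A. G w) = (\<Prod>k=1..card A. g k)"
  shows "(\<Sum>\<pi>\<in>signed_perms n. (\<Prod>k\<in>neg_letters (window n \<pi>). y k) * G (window n \<pi>)) =
    (\<Prod>k=1..n. q_bracket 2 (y k) * g k)"
proof -
  have "(\<Sum>\<pi>\<in>signed_perms n. (\<Prod>k\<in>neg_letters (window n \<pi>). y k) * G (window n \<pi>)) =
      (\<Sum>w\<in>signed_words n. (\<Prod>k\<in>neg_letters w. y k) * G w)"
    by (rule sum.reindex_bij_betw[OF bij_betw_window])
  also have "\<dots> = (\<Prod>k=1..n. q_bracket 2 (y k) * g k)"
    by (rule sum_signed_words_weighted) (simp add: assms card_signed_letters)
  finally show ?thesis .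
qed

section \<open>The six generating functions\<close>

lemma q_bracket_double: "q_bracket (2 * m) p = q_bracket 2 (p ^ m) * q_bracket m p"
proof -
  have "(\<Sum>i<m + k. p ^ i) = (\<Sum>i<m. p ^ i) + (\<Sum>i<k. p ^ (m + i))" for k
    by (induction k) (simp_all add: add_ac)
  then have "q_bracket (2 * m) p = (\<Sum>i<m. p ^ i) + (\<Sum>i<m. p ^ (m + i))"
    by (simp only: q_bracket_def mult_2)
  also have "\<dots> = q_bracket m p + p ^ m * q_bracket m p"
    by (simp only: q_bracket_def power_add sum_distrib_left)
  also have "\<dots> = q_bracket 2 (p ^ m) * q_bracket m p"
    by (simp add: q_bracket_2 distrib_right)
  finally show ?thesis .
qed

lemma neg_one_power_cong:
  "even (a + b) \<Longrightarrow> (- 1 :: 'b::comm_ring_1) ^ a = (- 1) ^ b"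
  by (cases "even a") auto

text \<open>The parity statement in multiplicative form, as a weight of the negative letters times the sign of
  the arrangement.\<close>
lemma sign_abs_perm:
  assumes "\<pi> \<in> signed_perms n"
  shows "(- 1 :: 'b::comm_ring_1) ^ inv_num n (abs_perm n \<pi>) =
    (\<Prod>k\<in>neg_letters (window n \<pi>). (- 1) ^ (k - 1)) * (- 1) ^ word_inv (window n \<pi>)"
proof -
  have "even (inv_num n (abs_perm n \<pi>) + ((\<Sum>k\<in>neg_letters (window n \<pi>). k - 1) + word_inv (window n \<pi>)))"
    using parity_inv_num_abs_perm[OF assms] by (simp add: ac_simps)
  from neg_one_power_cong[OF this] show ?thesis by (simp add: power_add power_sum)
qed

theorem corollary3p1:
  fixes n :: nat and q :: "'a::comm_ring_1"
  assumes "n \<ge> 1"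
  shows "((\<Sum>\<pi>\<in>signed_perms n. (- 1) ^ length_B n \<pi> * q ^ length_B n \<pi>)
           = (\<Prod>k=1..n. q_bracket (2 * k) (- q)))
     \<and> ((\<Sum>\<pi>\<in>signed_perms n. (- 1) ^ neg n \<pi> * q ^ length_B n \<pi>)
           = (\<Prod>k=1..n. q_bracket 2 (- (q ^ k)) * q_bracket k q))
     \<and> ((\<Sum>\<pi>\<in>signed_perms n. (- 1) ^ inv_num n (abs_perm n \<pi>) * q ^ length_B n \<pi>)
           = (\<Prod>k=1..n. q_bracket 2 ((- 1) ^ (k - 1) * q ^ k) * q_bracket k (- q)))
     \<and> ((\<Sum>\<pi>\<in>signed_perms n. (- 1) ^ length_B n \<pi> * q ^ nmaj n \<pi>)
           = (\<Prod>k=1..n. q_bracket 2 ((- q) ^ k) * q_bracket k ((- 1) ^ (k - 1) * q)))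
     \<and> ((\<Sum>\<pi>\<in>signed_perms n. (- 1) ^ neg n \<pi> * q ^ nmaj n \<pi>)
           = (\<Prod>k=1..n. q_bracket 2 (- (q ^ k)) * q_bracket k q))
     \<and> ((\<Sum>\<pi>\<in>signed_perms n. (- 1) ^ inv_num n (abs_perm n \<pi>) * q ^ nmaj n \<pi>)
           = (\<Prod>k=1..n. q_bracket 2 ((- 1) ^ (k - 1) * q ^ k) * q_bracket k ((- 1) ^ (k - 1) * q)))"
proof (intro conjI)
  let ?N = "\<lambda>\<pi>. neg_letters (window n \<pi>)"
  have by_inv: "(\<Sum>\<pi>\<in>signed_perms n. (\<Prod>k\<in>?N \<pi>. y k) * p ^ word_inv (window n \<pi>)) =
      (\<Prod>k=1..n. q_bracket 2 (y k) * q_bracket k p)" for y and p :: 'a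
    by (intro sum_signed_perms_weighted sum_power_word_inv)
  have by_signed_maj: "(\<Sum>\<pi>\<in>signed_perms n. (\<Prod>k\<in>?N \<pi>. y k) *
        ((- 1) ^ word_inv (window n \<pi>) * q ^ word_maj (window n \<pi>))) =
      (\<Prod>k=1..n. q_bracket 2 (y k) * q_bracket k ((- 1) ^ (k - 1) * q))" for y
    by (intro sum_signed_perms_weighted sum_sign_power_word_maj) simp
  have by_maj: "(\<Sum>\<pi>\<in>signed_perms n. (\<Prod>k\<in>?N \<pi>. y k) * q ^ word_maj (window n \<pi>)) =
      (\<Prod>k=1..n. q_bracket 2 (y k) * q_bracket k q)" for y
  proof (rule sum_signed_perms_weighted)
    fix A :: "int set" assume "finite A"
    then show "(\<Sum>w\<in>permutations_of_set A. q ^ word_maj w) = (\<Prod>k=1..card A. q_bracket k q)"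
      using sum_sign_power_word_maj[of 1 A q] by simp
  qed

  note stats = length_B_eq nmaj_eq neg_eq_card_neg_letters sign_abs_perm
  have neg_q: "(- 1) ^ i * q ^ i = (- q) ^ i" for i
    by (simp flip: power_mult_distrib)
  have length_weight: "(- 1) ^ \<Sum>N * q ^ \<Sum>N = (\<Prod>k\<in>N. (- q) ^ k)" for N
    unfolding neg_q by (rule power_sum)
  have neg_weight: "(- 1) ^ card N * q ^ \<Sum>N = (\<Prod>k\<in>N. - (q ^ k))" for N
    by (simp add: power_sum prod_uminus)
  have abs_weight: "(\<Prod>k\<in>N. (- 1) ^ (k - 1)) * q ^ \<Sum>N = (\<Prod>k\<in>N. (- 1) ^ (k - 1) * q ^ k)" for N
    by (simp add: power_sum prod.distrib)

  have "(\<Sum>\<pi>\<in>signed_perms n. (- 1) ^ length_B n \<pi> * q ^ length_B n \<pi>) =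
      (\<Sum>\<pi>\<in>signed_perms n. (\<Prod>k\<in>?N \<pi>. (- q) ^ k) * (- q) ^ word_inv (window n \<pi>))"
    by (intro sum.cong refl) (simp only: neg_q, simp only: stats power_add power_sum mult.commute)
  then show "(\<Sum>\<pi>\<in>signed_perms n. (- 1) ^ length_B n \<pi> * q ^ length_B n \<pi>) =
      (\<Prod>k=1..n. q_bracket (2 * k) (- q))"
    by (simp only: by_inv q_bracket_double)

  have "(\<Sum>\<pi>\<in>signed_perms n. (- 1) ^ neg n \<pi> * q ^ length_B n \<pi>) =
      (\<Sum>\<pi>\<in>signed_perms n. (\<Prod>k\<in>?N \<pi>. - (q ^ k)) * q ^ word_inv (window n \<pi>))"
    by (intro sum.cong refl) (simp only: stats power_add neg_weight[symmetric], simp only: mult_ac)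
  then show "(\<Sum>\<pi>\<in>signed_perms n. (- 1) ^ neg n \<pi> * q ^ length_B n \<pi>) =
      (\<Prod>k=1..n. q_bracket 2 (- (q ^ k)) * q_bracket k q)"
    by (simp only: by_inv)

  have "(\<Sum>\<pi>\<in>signed_perms n. (- 1) ^ inv_num n (abs_perm n \<pi>) * q ^ length_B n \<pi>) =
      (\<Sum>\<pi>\<in>signed_perms n. (\<Prod>k\<in>?N \<pi>. (- 1) ^ (k - 1) * q ^ k) * (- q) ^ word_inv (window n \<pi>))"
    by (intro sum.cong refl) (simp only: stats power_add abs_weight[symmetric] neg_q[symmetric], simp only: mult_ac)
  then show "(\<Sum>\<pi>\<in>signed_perms n. (- 1) ^ inv_num n (abs_perm n \<pi>) * q ^ length_B n \<pi>) =
      (\<Prod>k=1..n. q_bracket 2 ((- 1) ^ (k - 1) * q ^ k) * q_bracket k (- q))"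
    by (simp only: by_inv)

  have "(\<Sum>\<pi>\<in>signed_perms n. (- 1) ^ length_B n \<pi> * q ^ nmaj n \<pi>) =
      (\<Sum>\<pi>\<in>signed_perms n. (\<Prod>k\<in>?N \<pi>. (- q) ^ k) *
        ((- 1) ^ word_inv (window n \<pi>) * q ^ word_maj (window n \<pi>)))"
    by (intro sum.cong refl) (simp only: stats power_add length_weight[symmetric], simp only: mult_ac)
  then show "(\<Sum>\<pi>\<in>signed_perms n. (- 1) ^ length_B n \<pi> * q ^ nmaj n \<pi>) =
      (\<Prod>k=1..n. q_bracket 2 ((- q) ^ k) * q_bracket k ((- 1) ^ (k - 1) * q))"
    by (simp only: by_signed_maj)

  have "(\<Sum>\<pi>\<in>signed_perms n. (- 1) ^ neg n \<pi> * q ^ nmaj n \<pi>) =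
      (\<Sum>\<pi>\<in>signed_perms n. (\<Prod>k\<in>?N \<pi>. - (q ^ k)) * q ^ word_maj (window n \<pi>))"
    by (intro sum.cong refl) (simp only: stats power_add neg_weight[symmetric], simp only: mult_ac)
  then show "(\<Sum>\<pi>\<in>signed_perms n. (- 1) ^ neg n \<pi> * q ^ nmaj n \<pi>) =
      (\<Prod>k=1..n. q_bracket 2 (- (q ^ k)) * q_bracket k q)"
    by (simp only: by_maj)

  have "(\<Sum>\<pi>\<in>signed_perms n. (- 1) ^ inv_num n (abs_perm n \<pi>) * q ^ nmaj n \<pi>) =
      (\<Sum>\<pi>\<in>signed_perms n. (\<Prod>k\<in>?N \<pi>. (- 1) ^ (k - 1) * q ^ k) *
        ((- 1) ^ word_inv (window n \<pi>) * q ^ word_maj (window n \<pi>)))"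
    by (intro sum.cong refl) (simp only: stats power_add abs_weight[symmetric], simp only: mult_ac)
  then show "(\<Sum>\<pi>\<in>signed_perms n. (- 1) ^ inv_num n (abs_perm n \<pi>) * q ^ nmaj n \<pi>) =
      (\<Prod>k=1..n. q_bracket 2 ((- 1) ^ (k - 1) * q ^ k) * q_bracket k ((- 1) ^ (k - 1) * q))"
    by (simp only: by_signed_maj)
qed

end
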